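(* Let $(G,\upsilon,\varepsilon)$ be a weighted multigraph on $n$ vertices and let $S\subseteq V$, $|S|=k$, not contain (the vertex set of) any connected component of $G$. Let $\lambda_1\le\dots\le\lambda_n$ and $\mu_1\le\dots\le\mu_{n-k}$ denote the weighted Laplacian eigenvalues (with multiplicity) of $(G,\upsilon,\varepsilon)$ and its Kron reduction $(G/S,\upsilon,\varepsilon/S)$, respectively. Then $$\lambda_i\le\mu_i\le\lambda_{i+k}$$ for all $1\le i\le n-k$.
   Context: A graph is a finite multigraph with vertex set $V$ and edge set $E$ (loops and multiple edges allowed). A weighted multigraph $(G,\upsilon,\varepsilon)$ is a graph $G$ with vertex weights $\upsilon:V\to\mathbb R_{>0}$ and edge weights $\varepsilon:E\to\mathbb R_{>0}$. For $u,v\in V$, $\varepsilon(u,v)$ is the total edge weight between $u$ and $v$, with loops counted twice, and $d_{(G,\varepsilon)}(u)=\sum_{v\in V}\varepsilon(u,v)$. The combinatorial Laplacian is the $V\times V$ matrix $L_{(G,\varepsilon)}=D_{(G,\varepsilon)}-A_{(G,\varepsilon)}$, where $A_{(G,\varepsilon)}=(\varepsilon(u,v))_{u,v}$ and $D_{(G,\varepsilon)}$ is diagonal with entries $d_{(G,\varepsilon)}(v)$. The weighted Laplacian is $L_{(G,\upsilon,\varepsilon)}=W_\upsilon^{-1}L_{(G,\varepsilon)}$, acting on functions $V\to\mathbb R$, where $W_\upsilon$ is the diagonal matrix with entries $\upsilon(v)$; it is self-adjoint for the inner product $\langle f,g\rangle=\sum_{v}f(v)g(v)\upsilon(v)$,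 so its eigenvalues are real. A Kron reduction of $(G,\upsilon,\varepsilon)$ over $S\subseteq V$, where $S$ contains no connected component, is a weighted graph $(G/S,\upsilon,\varepsilon/S)$ with vertex set $S^c=V\setminus S$ and vertex weights given by $\upsilon$, such that for any $f:S^c\to\mathbb R$ and $u\in S^c$, $$L_{(G/S,\upsilon,\varepsilon/S)}f(u)=L_{(G,\upsilon,\varepsilon)}\tilde f(u),$$ where $\tilde f:V\to\mathbb R$ is the (unique) extension of $f$ satisfying $L_{(G,\upsilon,\varepsilon)}\tilde f(v)=0$ for all $v\in S$. Equivalently, writing $L_{(G,\upsilon,\varepsilon)}=\begin{pmatrix}L^{\hat S}&B\\C&D\end{pmatrix}$ in block form with the first rows and columns indexed by $S^c$, the matrix $D$ is invertible and $L_{(G/S,\upsilon,\varepsilon/S)}=L^{\hat S}-BD^{-1}C$. A Kron reduction exists and is unique up to adding or deleting loops and merging or splitting parallel edges (with edge weights added), operations which do not affect the weighted Laplacian. *)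

theory Defs
  imports
    Complex_Main
    "HOL-Library.Uprod"
    "HOL-Library.Multiset"
    "HOL-Computational_Algebra.Polynomial"
    "Jordan_Normal_Form.Char_Poly"
begin

section \<open>Weighted multigraphs\<close>

text \<open>Edges are abstract names carrying an unordered pair of end points, so parallel edges and
  loops (\<open>Upair u u\<close>) are allowed.\<close>

record ('v, 'e) wgraph =
  verts :: "'v set"
  edges :: "'e set"
  ends :: "'e \<Rightarrow> 'v uprod"
  vweight :: "'v \<Rightarrow> real"
  eweight :: "'e \<Rightarrow> real"

definition weighted_multigraph :: "('v, 'e) wgraph \<Rightarrow> bool" where
  "weighted_multigraph G \<longleftrightarrow>
     finite (verts G) \<and> finite (edges G) \<and>
     (\<forall>e\<in>edges G. set_uprod (ends G e) \<subseteq> verts G) \<and>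
     (\<forall>v\<in>verts G. vweight G v > 0) \<and>
     (\<forall>e\<in>edges G. eweight G e > 0)"

definition adj :: "('v, 'e) wgraph \<Rightarrow> 'v rel" where
  "adj G = {(u, v). \<exists>e\<in>edges G. ends G e = Upair u v}"

text \<open>The vertex sets of the connected components.\<close>

definition components :: "('v, 'e) wgraph \<Rightarrow> 'v set set" where
  "components G = (\<lambda>v. (adj G)\<^sup>* `` {v}) ` verts G"

section \<open>The weighted Laplacian\<close>

text \<open>\<open>tot_weight G u v\<close> is the total edge weight between \<open>u\<close> and \<open>v\<close>, with loops counted twice.\<close>

definition tot_weight :: "('v, 'e) wgraph \<Rightarrow> 'v \<Rightarrow> 'v \<Rightarrow> real" where
  "tot_weight G u v =
     (if u = v then 2 else 1) * (\<Sum>e | e \<in> edges G \<and> ends G e = Upair u v. eweight G e)"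

definition wdegree :: "('v, 'e) wgraph \<Rightarrow> 'v \<Rightarrow> real" where
  "wdegree G u = (\<Sum>v\<in>verts G. tot_weight G u v)"

text \<open>Entries of \<open>D - A\<close> and of \<open>W\<^sup>-\<^sup>1 (D - A)\<close>, and the action of the latter on functions.\<close>

definition comb_laplacian :: "('v, 'e) wgraph \<Rightarrow> 'v \<Rightarrow> 'v \<Rightarrow> real" where
  "comb_laplacian G u v = (if u = v then wdegree G u else 0) - tot_weight G u v"

definition laplacian :: "('v, 'e) wgraph \<Rightarrow> 'v \<Rightarrow> 'v \<Rightarrow> real" where
  "laplacian G u v = comb_laplacian G u v / vweight G u"

definition laplacian_op :: "('v, 'e) wgraph \<Rightarrow> ('v \<Rightarrow> real) \<Rightarrow> 'v \<Rightarrow> real" where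
  "laplacian_op G f u = (\<Sum>v\<in>verts G. laplacian G u v * f v)"

section \<open>Laplacian eigenvalues with multiplicity\<close>

definition matrix_of_list :: "('v \<Rightarrow> 'v \<Rightarrow> real) \<Rightarrow> 'v list \<Rightarrow> real mat" where
  "matrix_of_list M vs = mat (length vs) (length vs) (\<lambda>(i, j). M (vs ! i) (vs ! j))"

text \<open>The choice of the enumeration below is immaterial: see \<open>char_poly_on_eq\<close>.\<close>

definition char_poly_on :: "'v set \<Rightarrow> ('v \<Rightarrow> 'v \<Rightarrow> real) \<Rightarrow> real poly" where
  "char_poly_on V M = char_poly (matrix_of_list M (SOME vs. distinct vs \<and> set vs = V))"

lemma char_poly_matrix_of_list_cong:
  assumes "distinct vs" "distinct ws" "set vs = set ws"
  shows "char_poly (matrix_of_list M vs) = char_poly (matrix_of_list M ws)"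
proof -
  define n where "n = length vs"
  have "mset vs = mset ws"
    using assms by (simp add: set_eq_iff_mset_eq_distinct)
  then obtain p where p: "p permutes {..<length ws}" and vs: "permute_list p ws = vs"
    by (metis mset_eq_permutation)
  have len: "length ws = n"
    using vs by (auto simp: n_def)
  have p': "p permutes {0..<n}"
    using p len by (simp add: atLeast0LessThan)
  have nth: "vs ! i = ws ! p i" if "i < n" for i
    using that vs p len permute_list_nth by metis
  have p_less: "p i < n" if "i < n" for i
    using permutes_in_image[OF p', of i] that by simp
  have p_eq: "p i = p j \<longleftrightarrow> i = j" for i j
    using permutes_inj[OF p'] by (auto dest: injD)
  let ?B = "char_poly_matrix (matrix_of_list M ws)"
  have B: "?B \<in> carrier_mat n n"
    by (rule char_poly_matrix_closed) (simp add: matrix_of_list_def len)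
  define C where "C = mat n n (\<lambda>(i, j). ?B $$ (p i, j))"
  have C: "C \<in> carrier_mat n n" by (simp add: C_def)
  have eq: "char_poly_matrix (matrix_of_list M vs) =
      transpose_mat (mat n n (\<lambda>(i, j). transpose_mat C $$ (p i, j)))"
    by (rule eq_matI)
      (auto simp: char_poly_matrix_def matrix_of_list_def C_def len n_def[symmetric] nth p_less p_eq)
  have "det (char_poly_matrix (matrix_of_list M vs)) = signof p * det C"
    unfolding eq using det_permute_rows[OF _ p', of "transpose_mat C"] C
    by (simp add: det_transpose[of _ n])
  also have "det C = signof p * det ?B"
    unfolding C_def by (rule det_permute_rows[OF B p'])
  also have "signof p * (signof p * det ?B) = det ?B"
    by (simp add: sign_def)
  finally show ?thesis
    by (simp add: char_poly_def)
qed

lemma char_poly_on_eq: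
  assumes "distinct vs" "set vs = V"
  shows "char_poly_on V M = char_poly (matrix_of_list M vs)"
  unfolding char_poly_on_def
  by (rule someI2[where a = vs]) (use assms in \<open>auto intro: char_poly_matrix_of_list_cong\<close>)

text \<open>\<open>laplacian_eigenvalue G i\<close>, for \<open>1 \<le> i \<le> card (verts G)\<close>, is the \<open>i\<close>-th smallest eigenvalue.
  The multiplicities are those of the roots of the characteristic polynomial; they agree with the
  dimensions of the eigenspaces since the Laplacian is self-adjoint.\<close>

definition laplacian_eigenvalues :: "('v, 'e) wgraph \<Rightarrow> real list" where
  "laplacian_eigenvalues G =
     sorted_list_of_multiset (proots (char_poly_on (verts G) (laplacian G)))"

definition laplacian_eigenvalue :: "('v, 'e) wgraph \<Rightarrow> nat \<Rightarrow> real" where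
  "laplacian_eigenvalue G i = laplacian_eigenvalues G ! (i - 1)"

section \<open>Kron reductions\<close>

definition harmonic_extension ::
  "('v, 'e) wgraph \<Rightarrow> 'v set \<Rightarrow> ('v \<Rightarrow> real) \<Rightarrow> ('v \<Rightarrow> real) \<Rightarrow> bool" where
  "harmonic_extension G S f g \<longleftrightarrow>
     (\<forall>u\<in>verts G - S. g u = f u) \<and> (\<forall>v\<in>S. laplacian_op G g v = 0)"

text \<open>When \<open>S\<close> contains no component, the extension \<open>g\<close> exists and is unique on \<open>verts G\<close>; its
  values outside \<open>verts G\<close> are irrelevant. The reduction is a relation, not a function, since it is
  determined only up to loops and splitting of parallel edges; its edge names are arbitrary.\<close>

definition kron_reduction :: "('v, 'e) wgraph \<Rightarrow> 'v set \<Rightarrow> ('v, 'f) wgraph \<Rightarrow> bool" where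
  "kron_reduction G S H \<longleftrightarrow>
     weighted_multigraph H \<and>
     verts H = verts G - S \<and>
     (\<forall>u\<in>verts H. vweight H u = vweight G u) \<and>
     (\<forall>f g. harmonic_extension G S f g \<longrightarrow>
        (\<forall>u\<in>verts H. laplacian_op H f u = laplacian_op G g u))"

end

theory Submission
  imports Defs "Jordan_Normal_Form.Spectral_Radius"
begin

text \<open>Let \<open>\<lambda>\<^sub>1 \<le> \<lambda>\<^sub>2 \<le> \<dots>\<close> and \<open>\<mu>\<^sub>1 \<le> \<mu>\<^sub>2 \<le> \<dots>\<close> be the eigenvalues of \<open>G\<close> and of its Kron reduction \<open>H\<close>, and
  write \<open>Q\<^sub>G(g) = \<langle>g, L\<^sub>G g\<rangle>\<close> for the Dirichlet energy in the inner product given by the vertex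
  weights. Three facts tie \<open>G\<close> and \<open>H\<close> together, where \<open>f\<close> lives on \<open>V - S\<close> and \<open>f~\<close> is its harmonic extension:

  \<^item> \<open>Q\<^sub>H(f) = Q\<^sub>G(f~)\<close>, because \<open>L\<^sub>G f~\<close> vanishes on \<open>S\<close> and agrees with \<open>L\<^sub>H f\<close> elsewhere
    (\<open>kron_reduction_energy\<close>);
  \<^item> \<open>Q\<^sub>G(f~) \<le> Q\<^sub>G(g)\<close> for every other extension \<open>g\<close> of \<open>f\<close>
    (\<open>harmonic_extension_minimises_energy\<close>);
  \<^item> \<open>\<parallel>f\<parallel> \<le> \<parallel>f~\<parallel>\<close>, and \<open>\<parallel>f\<parallel> = \<parallel>g\<parallel>\<close> for the extension \<open>g\<close> of \<open>f\<close> by zero.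

  For \<open>\<lambda>\<^sub>i \<le> \<mu>\<^sub>i\<close>, extend the span of the \<open>i\<close> lowest eigenfunctions of \<open>H\<close> harmonically to \<open>G\<close>: this
  keeps the energy and does not decrease the norm, so, as \<open>\<mu>\<^sub>i \<ge> 0\<close>, the Rayleigh quotient stays at
  most \<open>\<mu>\<^sub>i\<close> on an \<open>i\<close>-dimensional space. For \<open>\<mu>\<^sub>i \<le> \<lambda>\<^bsub>i+k\<^esub>\<close>, take the span of the \<open>i + k\<close> lowest
  eigenfunctions of \<open>G\<close> and impose the \<open>k\<close> conditions of vanishing on \<open>S\<close>: on the remaining space, of
  dimension at least \<open>i\<close>, restriction to \<open>V - S\<close> keeps the norm and does not increase the energy.
  The min-max principle (\<open>eigenvalue_le_min_max\<close>) turns both into eigenvalue bounds.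

  The min-max principle needs an orthonormal eigenbasis indexed by the roots of the characteristic
  polynomial in increasing order (\<open>principal_axes_exist\<close>). It comes from the spectral theorem for real
  symmetric matrices (\<open>symmetric_real_mat_diagonalisable\<close>) applied to
  \<open>W\<^bsup>-1/2\<^esup> (D - A) W\<^bsup>-1/2\<^esup>\<close>, which is symmetric and similar to the weighted Laplacian. Dimension
  counts only ever enter as the existence of a nonzero solution of a homogeneous linear system with more
  unknowns than equations (\<open>underdetermined_system_solution\<close>).\<close>

section \<open>The spectral theorem for real symmetric matrices\<close>

text \<open>A complex eigenvalue \<open>\<mu>\<close> with eigenvector \<open>v\<close> exists. The number \<open>v\<^sup>* A v = \<mu> v\<^sup>* v\<close> is invariant under
  conjugation by symmetry of \<open>A\<close>, so \<open>\<mu>\<close> is real, and then it is a root of the characteristic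
  polynomial over the reals as well.\<close>

lemma symmetric_real_mat_has_eigenvalue:
  fixes A :: "real mat"
  assumes A: "A \<in> carrier_mat n n" and sym: "transpose_mat A = A" and "n > 0"
  shows "\<exists>r. eigenvalue A r"
proof -
  let ?C = "map_mat complex_of_real A"
  have C: "?C \<in> carrier_mat n n"
    using A by simp
  obtain \<mu> where "eigenvalue ?C \<mu>"
    using spectrum_non_empty[OF C \<open>n > 0\<close>] by (auto simp: spectrum_def)
  then obtain v where v: "v \<in> carrier_vec n" "v \<noteq> 0\<^sub>v n" and eq: "?C *\<^sub>v v = \<mu> \<cdot>\<^sub>v v"
    using C A by (auto simp: eigenvalue_def eigenvector_def)
  have sym': "A $$ (i, j) = A $$ (j, i)" if "i < n" "j < n" for i j
    using sym that A by (metis carrier_matD index_transpose_mat(1))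
  have row: "(\<Sum>j<n. complex_of_real (A $$ (i, j)) * v $ j) = \<mu> * v $ i" if "i < n" for i
  proof -
    have "(?C *\<^sub>v v) $ i = \<mu> * v $ i"
      using eq v that by simp
    then show ?thesis
      using that A v by (simp add: scalar_prod_def atLeast0LessThan)
  qed
  define N where "N = (\<Sum>i<n. (cmod (v $ i))\<^sup>2)"
  define Q where "Q = (\<Sum>i<n. \<Sum>j<n. complex_of_real (A $$ (i, j)) * (cnj (v $ i) * v $ j))"
  have "Q = (\<Sum>i<n. cnj (v $ i) * (\<mu> * v $ i))"
    unfolding Q_def by (simp add: row[symmetric] sum_distrib_left mult_ac)
  also have "\<dots> = \<mu> * of_real N"
    unfolding N_def of_real_sum sum_distrib_left
    by (intro sum.cong refl) (simp add: complex_norm_square del: of_real_power)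
  finally have Q: "Q = \<mu> * of_real N" .
  have "cnj Q = (\<Sum>i<n. \<Sum>j<n. complex_of_real (A $$ (i, j)) * (cnj (v $ j) * v $ i))"
    unfolding Q_def by (simp add: mult_ac)
  also have "\<dots> = (\<Sum>j<n. \<Sum>i<n. complex_of_real (A $$ (i, j)) * (cnj (v $ j) * v $ i))"
    by (rule sum.swap)
  also have "\<dots> = Q"
    unfolding Q_def by (intro sum.cong refl) (simp add: sym')
  finally have "cnj Q = Q" .
  have "N > 0"
  proof -
    obtain i where "i < n" "v $ i \<noteq> 0"
      using v by (metis carrier_vecD dim_vec eq_vecI index_zero_vec(1) index_zero_vec(2))
    then show ?thesis
      unfolding N_def by (intro sum_pos2[of _ i]) auto
  qed
  then have "cnj \<mu> = \<mu>"
    using \<open>cnj Q = Q\<close> unfolding Q by simp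
  then obtain r where r: "\<mu> = of_real r"
    by (metis Reals_cases Reals_cnj_iff)
  have "poly (char_poly ?C) \<mu> = 0"
    using \<open>eigenvalue ?C \<mu>\<close> eigenvalue_root_char_poly[OF C] by simp
  then have "poly (char_poly A) r = 0"
    unfolding of_real_hom.char_poly_hom[OF A] r by simp
  then show ?thesis
    using eigenvalue_root_char_poly[OF A] by blast
qed

text \<open>Unless \<open>v\<close> is the first unit vector \<open>e\<close> itself, the Householder reflection that exchanges \<open>e\<close> and \<open>v\<close>
  is such a matrix. It replaces a Gram-Schmidt completion of \<open>v\<close> to an orthonormal basis.\<close>

lemma orthogonal_symmetric_mat_first_column:
  fixes v :: "real vec"
  assumes v: "v \<in> carrier_vec n" and unit: "(\<Sum>i<n. (v $ i)\<^sup>2) = 1" and "n > 0"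
  shows "\<exists>H \<in> carrier_mat n n. transpose_mat H = H \<and> H * H = 1\<^sub>m n \<and> (\<forall>i<n. H $$ (i, 0) = v $ i)"
proof (cases "v $ 0 = 1")
  case True
  have "(\<Sum>i<n. (v $ i)\<^sup>2) = (v $ 0)\<^sup>2 + (\<Sum>i\<in>{..<n} - {0}. (v $ i)\<^sup>2)"
    using \<open>n > 0\<close> by (subst sum.remove[of _ 0]) auto
  then have "(\<Sum>i\<in>{..<n} - {0}. (v $ i)\<^sup>2) = 0"
    using unit True by simp
  then have "v $ i = 0" if "i < n" "i \<noteq> 0" for i
    using that by (subst (asm) sum_nonneg_eq_0_iff) auto
  then have "\<forall>i<n. (1\<^sub>m n :: real mat) $$ (i, 0) = v $ i"
    using True \<open>n > 0\<close> by (metis index_one_mat(1))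
  then show ?thesis
    by (intro bexI[of _ "1\<^sub>m n"]) auto
next
  case False
  \<comment> \<open>The reflection is \<open>1 - c w w\<^sup>T\<close> with \<open>w = v - e\<close> and \<open>c = 2 / (w \<bullet> w)\<close>; as \<open>v\<close> and \<open>e\<close> are
    unit vectors, \<open>w \<bullet> w = 2 - 2 v\<^sub>0\<close>.\<close>
  define w where "w i = v $ i - of_bool (i = 0)" for i :: nat
  define c where "c = 1 / (1 - v $ 0)"
  have "(\<Sum>i<n. (w i)\<^sup>2) = (\<Sum>i<n. (v $ i)\<^sup>2 + (if i = 0 then 1 - 2 * v $ 0 else 0))"
    unfolding w_def by (intro sum.cong refl) (auto simp: power2_eq_square algebra_simps)
  also have "\<dots> = 2 * (1 - v $ 0)"
    using unit \<open>n > 0\<close> by (simp only: sum.distrib) simp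
  finally have ww: "(\<Sum>i<n. (w i)\<^sup>2) = 2 * (1 - v $ 0)" .
  define H where "H = mat n n (\<lambda>(i, j). of_bool (i = j) - c * w i * w j)"
  have "H * H = 1\<^sub>m n"
  proof (rule eq_matI)
    fix i j assume ij: "i < dim_row (1\<^sub>m n :: real mat)" "j < dim_col (1\<^sub>m n :: real mat)"
    have "(H * H) $$ (i, j) =
        (\<Sum>k<n. (of_bool (i = k) - c * w i * w k) * (of_bool (k = j) - c * w k * w j))"
      using ij by (simp add: H_def scalar_prod_def atLeast0LessThan)
    also have "\<dots> = (\<Sum>k<n. (if k = i then of_bool (i = j) else 0) - (if k = i then c * w i * w j else 0)
        - (if k = j then c * w i * w j else 0) + c\<^sup>2 * w i * w j * (w k)\<^sup>2)"
      by (intro sum.cong refl) (auto simp: power2_eq_square algebra_simps)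
    also have "\<dots> = of_bool (i = j) - 2 * c * w i * w j + c\<^sup>2 * w i * w j * (\<Sum>k<n. (w k)\<^sup>2)"
      using ij by (simp add: sum.distrib sum_subtractf sum_distrib_left)
    also have "\<dots> = of_bool (i = j)"
    proof -
      have "c * (1 - v $ 0) = 1"
        using False by (simp add: c_def)
      moreover have "c\<^sup>2 * w i * w j * (\<Sum>k<n. (w k)\<^sup>2) = 2 * c * w i * w j * (c * (1 - v $ 0))"
        unfolding ww by (simp add: power2_eq_square)
      ultimately have "c\<^sup>2 * w i * w j * (\<Sum>k<n. (w k)\<^sup>2) = 2 * c * w i * w j"
        by simp
      then show ?thesis
        by simp
    qed
    finally show "(H * H) $$ (i, j) = 1\<^sub>m n $$ (i, j)"
      using ij by simp
  qed (auto simp: H_def)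
  moreover have "transpose_mat H = H"
    by (rule eq_matI) (auto simp: H_def)
  moreover have "H $$ (i, 0) = v $ i" if "i < n" for i
  proof -
    have "c * w 0 = - 1"
      using False by (simp add: c_def w_def field_simps)
    then have "c * w i * w 0 = - w i"
      by (metis mult.assoc mult.commute mult_minus1_right)
    then show ?thesis
      using that \<open>n > 0\<close> by (simp add: H_def) (simp add: w_def)
  qed
  ultimately show ?thesis
    by (intro bexI[of _ H]) (auto simp: H_def)
qed

text \<open>Deflation: conjugating by an orthogonal matrix whose first column is an eigenvector makes the first
  column of the matrix a multiple of the first unit vector. Symmetry then clears the first row too,
  and the induction hypothesis applies to the remaining block.\<close>

lemma symmetric_real_mat_diagonalisable:
  fixes A :: "real mat"
  assumes "A \<in> carrier_mat n n" "transpose_mat A = A"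
  shows "\<exists>U D. U \<in> carrier_mat n n \<and> D \<in> carrier_mat n n \<and> diagonal_mat D \<and>
    transpose_mat U * U = 1\<^sub>m n \<and> A = U * D * transpose_mat U"
  using assms
proof (induction n arbitrary: A)
  case 0
  then show ?case
    by (intro exI[of _ "1\<^sub>m 0"] exI[of _ A]) (auto simp: diagonal_mat_def)
next
  case (Suc n)
  let ?N = "Suc n"
  note A = Suc.prems(1)
  obtain r where "eigenvalue A r"
    using symmetric_real_mat_has_eigenvalue[OF Suc.prems] by auto
  then obtain v0 where v0: "v0 \<in> carrier_vec ?N" "v0 \<noteq> 0\<^sub>v ?N" and ev0: "A *\<^sub>v v0 = r \<cdot>\<^sub>v v0"
    using A by (auto simp: eigenvalue_def eigenvector_def)
  define s where "s = (\<Sum>i<?N. (v0 $ i)\<^sup>2)"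
  have "s > 0"
  proof -
    obtain i where "i < ?N" "v0 $ i \<noteq> 0"
      using v0 by (metis carrier_vecD dim_vec eq_vecI index_zero_vec(1) index_zero_vec(2))
    then show ?thesis
      unfolding s_def by (intro sum_pos2[of _ i]) auto
  qed
  define v where "v = (1 / sqrt s) \<cdot>\<^sub>v v0"
  have v: "v \<in> carrier_vec ?N"
    using v0 by (simp add: v_def)
  have "(\<Sum>i<?N. (v $ i)\<^sup>2) = (\<Sum>i<?N. (v0 $ i)\<^sup>2 / s)"
    using v0 \<open>s > 0\<close> by (intro sum.cong refl) (simp add: v_def power_divide power_mult_distrib)
  also have "\<dots> = 1"
    using \<open>s > 0\<close> unfolding s_def by (simp add: sum_divide_distrib[symmetric] del: sum.lessThan_Suc)
  finally have unit: "(\<Sum>i<?N. (v $ i)\<^sup>2) = 1" .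
  have ev: "A *\<^sub>v v = r \<cdot>\<^sub>v v"
    using A v0 ev0 unfolding v_def
    by (simp add: mult_mat_vec smult_smult_assoc mult.commute)
  obtain H where H: "H \<in> carrier_mat ?N ?N" "transpose_mat H = H" "H * H = 1\<^sub>m ?N"
    and H0: "\<forall>i<?N. H $$ (i, 0) = v $ i"
    using orthogonal_symmetric_mat_first_column[OF v unit] by auto
  have colH: "col H 0 = v"
    using H0 H v by (intro eq_vecI) auto
  define B where "B = H * A * H"
  have B: "B \<in> carrier_mat ?N ?N"
    using H A by (simp add: B_def)
  have symB: "transpose_mat B = B"
    using H A Suc.prems(2) unfolding B_def
    by (simp add: transpose_mult[of _ ?N ?N _ ?N] assoc_mult_mat[of _ ?N ?N _ ?N _ ?N])
  have B': "B $$ (i, j) = B $$ (j, i)" if "i < ?N" "j < ?N" for i j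
    using symB that B by (metis carrier_matD index_transpose_mat(1))
  have "col B 0 = (H * A) *\<^sub>v v"
    unfolding B_def using H A colH by (subst col_mult2[of _ ?N ?N _ ?N]) auto
  also have "\<dots> = H *\<^sub>v (A *\<^sub>v v)"
    using H A v by (simp add: assoc_mult_mat_vec)
  also have "\<dots> = r \<cdot>\<^sub>v (H *\<^sub>v v)"
    using H v by (simp add: ev mult_mat_vec)
  also have "H *\<^sub>v v = col (H * H) 0"
    using H colH by (subst col_mult2[of _ ?N ?N _ ?N]) auto
  finally have colB: "col B 0 = r \<cdot>\<^sub>v unit_vec ?N 0"
    by (simp add: H)
  have B0: "B $$ (i, 0) = (if i = 0 then r else 0)" if "i < ?N" for i
    using arg_cong[OF colB, of "\<lambda>x. x $ i"] that B by simp
  define A' where "A' = mat n n (\<lambda>(i, j). B $$ (Suc i, Suc j))"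
  have A': "A' \<in> carrier_mat n n" "transpose_mat A' = A'"
    using B' by (auto simp: A'_def intro!: eq_matI)
  have BA': "B = four_block_mat (r \<cdot>\<^sub>m 1\<^sub>m 1) (0\<^sub>m 1 n) (0\<^sub>m n 1) A'"
  proof (rule eq_matI)
    fix i j
    assume "i < dim_row (four_block_mat (r \<cdot>\<^sub>m 1\<^sub>m 1) (0\<^sub>m 1 n) (0\<^sub>m n 1) A')"
      and "j < dim_col (four_block_mat (r \<cdot>\<^sub>m 1\<^sub>m 1) (0\<^sub>m 1 n) (0\<^sub>m n 1) A')"
    then have ij: "i < ?N" "j < ?N"
      using A' by auto
    then show "B $$ (i, j) = four_block_mat (r \<cdot>\<^sub>m 1\<^sub>m 1) (0\<^sub>m 1 n) (0\<^sub>m n 1) A' $$ (i, j)"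
      using A' B0[of i] B0[of j] B'[of 0 j] by (auto simp: A'_def)
  qed (use B A' in auto)
  obtain U D where U: "U \<in> carrier_mat n n" and D: "D \<in> carrier_mat n n" "diagonal_mat D"
    and UU: "transpose_mat U * U = 1\<^sub>m n" and UD: "A' = U * D * transpose_mat U"
    using Suc.IH[OF A'] by blast
  define U1 where "U1 = four_block_mat (1\<^sub>m 1) (0\<^sub>m 1 n) (0\<^sub>m n 1) U"
  define D1 where "D1 = four_block_mat (r \<cdot>\<^sub>m 1\<^sub>m 1) (0\<^sub>m 1 n) (0\<^sub>m n 1) D"
  have U1: "U1 \<in> carrier_mat ?N ?N" and D1: "D1 \<in> carrier_mat ?N ?N"
    using U D four_block_carrier_mat[of "1\<^sub>m 1" 1 1 U n n]
      four_block_carrier_mat[of "r \<cdot>\<^sub>m 1\<^sub>m 1" 1 1 D n n] by (auto simp: U1_def D1_def)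
  have U1t: "transpose_mat U1 = four_block_mat (1\<^sub>m 1) (0\<^sub>m 1 n) (0\<^sub>m n 1) (transpose_mat U)"
    unfolding U1_def using U by (subst transpose_four_block_mat[of _ 1 1 _ n _ n]) auto
  have blk: "four_block_mat P (0\<^sub>m 1 n) (0\<^sub>m n 1) X * four_block_mat Q (0\<^sub>m 1 n) (0\<^sub>m n 1) Y
      = four_block_mat (P * Q) (0\<^sub>m 1 n) (0\<^sub>m n 1) (X * Y)"
    if "P \<in> carrier_mat 1 1" "Q \<in> carrier_mat 1 1" "X \<in> carrier_mat n n" "Y \<in> carrier_mat n n"
    for P Q X Y :: "real mat"
    using that by (subst mult_four_block_mat[of _ 1 1 _ n _ n]) auto
  have orthU1: "transpose_mat U1 * U1 = 1\<^sub>m ?N"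
    unfolding U1t unfolding U1_def using U by (subst blk) (auto simp: UU intro!: eq_matI)
  have BU: "B = U1 * D1 * transpose_mat U1"
  proof -
    have U1D1: "U1 * D1 = four_block_mat (r \<cdot>\<^sub>m 1\<^sub>m 1) (0\<^sub>m 1 n) (0\<^sub>m n 1) (U * D)"
      unfolding U1_def D1_def using U D by (subst blk) auto
    show ?thesis
      unfolding U1t U1D1 BA' UD using U D by (subst blk) auto
  qed
  have diag: "diagonal_mat D1"
    unfolding diagonal_mat_def D1_def using D(1) D(2)
    by (auto simp: diagonal_mat_def)
  have orth: "transpose_mat (H * U1) * (H * U1) = 1\<^sub>m ?N"
  proof -
    have "transpose_mat (H * U1) * (H * U1) = transpose_mat U1 * (H * H) * U1"
      using H(1,2) U1
      by (simp add: transpose_mult[of _ ?N ?N _ ?N] assoc_mult_mat[of _ ?N ?N _ ?N _ ?N])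
    then show ?thesis
      using U1 orthU1 by (simp add: H(3))
  qed
  have "A = (H * H) * A * (H * H)"
    using A by (simp add: H(3))
  also have "\<dots> = H * B * H"
    unfolding B_def using H(1) A by (simp add: assoc_mult_mat[of _ ?N ?N _ ?N _ ?N])
  also have "\<dots> = (H * U1) * D1 * transpose_mat (H * U1)"
    unfolding BU using H(1,2) U1 D1
    by (simp add: transpose_mult[of _ ?N ?N _ ?N] assoc_mult_mat[of _ ?N ?N _ ?N _ ?N])
  finally show ?case
    using orth H(1) U1 D1 diag by (intro exI[of _ "H * U1"] exI[of _ D1]) auto
qed

section \<open>Quadratic forms relative to a weighted inner product\<close>

definition weighted_inner :: "'v set \<Rightarrow> ('v \<Rightarrow> real) \<Rightarrow> ('v \<Rightarrow> real) \<Rightarrow> ('v \<Rightarrow> real) \<Rightarrow> real" where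
  "weighted_inner V w f g = (\<Sum>u\<in>V. w u * f u * g u)"

definition quad_form :: "'v set \<Rightarrow> ('v \<Rightarrow> 'v \<Rightarrow> real) \<Rightarrow> ('v \<Rightarrow> real) \<Rightarrow> real" where
  "quad_form V K g = (\<Sum>u\<in>V. \<Sum>v\<in>V. K u v * g u * g v)"

text \<open>An eigenbasis \<open>p\<close>, orthonormal for the weighted inner product, of the operator \<open>W\<^sup>-\<^sup>1 K\<close>, recorded through
  what variational arguments use: the Parseval identity (completeness of \<open>p\<close>) and the diagonal shape of
  the form \<open>K\<close> in the coordinates with respect to \<open>p\<close>. Functions are only looked at on \<open>V\<close>.\<close>

definition principal_axes ::
  "'v set \<Rightarrow> ('v \<Rightarrow> real) \<Rightarrow> ('v \<Rightarrow> 'v \<Rightarrow> real) \<Rightarrow> real list \<Rightarrow> (nat \<Rightarrow> 'v \<Rightarrow> real) \<Rightarrow> bool" where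
  "principal_axes V w K es p \<longleftrightarrow>
     length es = card V \<and> sorted es \<and>
     (\<forall>i<card V. \<forall>j<card V. weighted_inner V w (p i) (p j) = of_bool (i = j)) \<and>
     (\<forall>g. weighted_inner V w g g = (\<Sum>j<card V. (weighted_inner V w g (p j))\<^sup>2)) \<and>
     (\<forall>g. quad_form V K g = (\<Sum>j<card V. es ! j * (weighted_inner V w g (p j))\<^sup>2))"

text \<open>Conjugating \<open>W\<^sup>-\<^sup>1 K\<close> with \<open>W\<^bsup>1/2\<^esup>\<close> gives the symmetric matrix \<open>N = W\<^bsup>-1/2\<^esup> K W\<^bsup>-1/2\<^esup>\<close>. If \<open>N = U D U\<^sup>T\<close>
  with \<open>U\<close> orthogonal, then \<open>W\<^sup>-\<^sup>1 K\<close> is similar to \<open>D\<close>, which identifies the roots of its characteristic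
  polynomial with the diagonal of \<open>D\<close>, and the columns of \<open>W\<^bsup>-1/2\<^esup> U\<close> are the axes.\<close>

lemma principal_axes_exist:
  fixes V :: "'v set" and w :: "'v \<Rightarrow> real" and K :: "'v \<Rightarrow> 'v \<Rightarrow> real"
  assumes "finite V" and w: "\<And>u. u \<in> V \<Longrightarrow> w u > 0"
    and sym: "\<And>u v. u \<in> V \<Longrightarrow> v \<in> V \<Longrightarrow> K u v = K v u"
  shows "\<exists>p. principal_axes V w K
    (sorted_list_of_multiset (proots (char_poly_on V (\<lambda>u v. K u v / w u)))) p"
proof -
  obtain vs where vs: "distinct vs" "set vs = V"
    using finite_distinct_list[OF \<open>finite V\<close>] by auto
  define n where "n = length vs"
  have card: "card V = n"
    using vs by (auto simp: n_def distinct_card)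
  have bij: "bij_betw ((!) vs) {..<n} V"
    using bij_betw_nth[OF vs(1), of "{..<n}" V] vs by (simp add: n_def)
  have mem: "vs ! i \<in> V" if "i < n" for i
    using that vs by (auto simp: n_def)
  define s where "s i = sqrt (w (vs ! i))" for i
  have s: "s i > 0" "s i * s i = w (vs ! i)" if "i < n" for i
    using w[OF mem[OF that]] by (auto simp: s_def)
  define N where "N = mat n n (\<lambda>(i, j). K (vs ! i) (vs ! j) / (s i * s j))"
  have N: "N \<in> carrier_mat n n"
    by (simp add: N_def)
  have "transpose_mat N = N"
    by (rule eq_matI) (auto simp: N_def sym mem mult.commute)
  from symmetric_real_mat_diagonalisable[OF N this]
  obtain U D where U: "U \<in> carrier_mat n n" and D: "D \<in> carrier_mat n n" "diagonal_mat D"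
    and UtU: "transpose_mat U * U = 1\<^sub>m n" and NU: "N = U * D * transpose_mat U"
    by auto
  have UUt: "U * transpose_mat U = 1\<^sub>m n"
    using mat_mult_left_right_inverse[OF _ U UtU] U by simp
  define d where "d = diag_mat D"
  have d: "length d = n"
    using D by (simp add: d_def diag_mat_def)
  have col: "(\<Sum>i<n. U $$ (i, j) * U $$ (i, k)) = of_bool (j = k)" if "j < n" "k < n" for j k
    using arg_cong[OF UtU, of "\<lambda>M. M $$ (j, k)"] that U
    by (simp add: scalar_prod_def atLeast0LessThan)
  have row: "(\<Sum>j<n. U $$ (i, j) * U $$ (k, j)) = of_bool (i = k)" if "i < n" "k < n" for i k
    using arg_cong[OF UUt, of "\<lambda>M. M $$ (i, k)"] that U
    by (simp add: scalar_prod_def atLeast0LessThan)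
  have UD: "(U * D) $$ (i, j) = d ! j * U $$ (i, j)" if "i < n" "j < n" for i j
  proof -
    have "(U * D) $$ (i, j) = (\<Sum>l<n. U $$ (i, l) * D $$ (l, j))"
      using that U D by (simp add: scalar_prod_def atLeast0LessThan)
    also have "\<dots> = (\<Sum>l<n. if l = j then d ! j * U $$ (i, j) else 0)"
      using that D by (intro sum.cong refl) (auto simp: d_def diag_mat_def diagonal_mat_def)
    finally show ?thesis
      using that by simp
  qed
  have Nij: "K (vs ! i) (vs ! k) = s i * s k * (\<Sum>j<n. d ! j * (U $$ (i, j) * U $$ (k, j)))"
    if "i < n" "k < n" for i k
  proof -
    have "N $$ (i, k) = (\<Sum>j<n. (U * D) $$ (i, j) * U $$ (k, j))"
      unfolding NU using that U D by (simp add: scalar_prod_def atLeast0LessThan del: assoc_mult_mat)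
    then show ?thesis
      using that s(1)[of i] s(1)[of k] by (simp add: N_def UD field_simps)
  qed
  let ?M = "matrix_of_list (\<lambda>u v. K u v / w u) vs"
  define es where "es = sorted_list_of_multiset (proots (char_poly_on V (\<lambda>u v. K u v / w u)))"
  have "similar_mat ?M D"
  proof -
    define P where "P = mat n n (\<lambda>(i, j). U $$ (i, j) / s i)"
    define Q where "Q = mat n n (\<lambda>(i, j). U $$ (j, i) * s j)"
    have PD: "(P * D) $$ (i, j) = d ! j * U $$ (i, j) / s i" if "i < n" "j < n" for i j
    proof -
      have "(P * D) $$ (i, j) = (U * D) $$ (i, j) / s i"
        using that U D by (simp add: P_def scalar_prod_def sum_divide_distrib)
      then show ?thesis
        using that by (simp add: UD)
    qed
    have "P * Q = 1\<^sub>m n"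
    proof (rule eq_matI)
      fix i j assume "i < dim_row (1\<^sub>m n :: real mat)" "j < dim_col (1\<^sub>m n :: real mat)"
      then have ij: "i < n" "j < n" by auto
      have "(P * Q) $$ (i, j) = s j / s i * (\<Sum>k<n. U $$ (i, k) * U $$ (j, k))"
        using ij unfolding P_def Q_def sum_distrib_left
        by (auto simp: scalar_prod_def atLeast0LessThan intro!: sum.cong)
      then show "(P * Q) $$ (i, j) = 1\<^sub>m n $$ (i, j)"
        using ij s(1)[of i] by (cases "i = j") (simp_all add: row)
    qed (auto simp: P_def Q_def)
    moreover from this have "Q * P = 1\<^sub>m n"
      by (rule mat_mult_left_right_inverse[rotated 2]) (auto simp: P_def Q_def)
    moreover have "?M = P * D * Q"
    proof (rule eq_matI)
      fix i k assume "i < dim_row (P * D * Q)" "k < dim_col (P * D * Q)"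
      then have ik: "i < n" "k < n" by (auto simp: P_def Q_def)
      have "(P * D * Q) $$ (i, k) = (\<Sum>j<n. (P * D) $$ (i, j) * Q $$ (j, k))"
        using ik D by (simp add: P_def Q_def scalar_prod_def atLeast0LessThan del: assoc_mult_mat)
      also have "\<dots> = s k / s i * (\<Sum>j<n. d ! j * (U $$ (i, j) * U $$ (k, j)))"
        using ik unfolding sum_distrib_left by (auto simp: PD Q_def intro!: sum.cong)
      also have "\<dots> = K (vs ! i) (vs ! k) / w (vs ! i)"
        using ik s[of i] by (simp add: Nij s(2)[symmetric])
      finally show "?M $$ (i, k) = (P * D * Q) $$ (i, k)"
        using ik by (simp add: matrix_of_list_def n_def)
    qed (auto simp: P_def Q_def matrix_of_list_def n_def)
    ultimately show ?thesis
      using D by (intro similar_matI[of _ _ P Q n]) (auto simp: P_def Q_def matrix_of_list_def n_def)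
  qed
  then have "char_poly ?M = char_poly D"
    by (rule char_poly_similar)
  also have "\<dots> = (\<Prod>a\<leftarrow>d. [:- a, 1:])"
    unfolding d_def using D by (intro char_poly_upper_triangular) (auto simp: diagonal_mat_def)
  finally have "char_poly_on V (\<lambda>u v. K u v / w u) = (\<Prod>a\<leftarrow>d. [:- a, 1:])"
    using char_poly_on_eq[OF vs] by simp
  moreover have "proots (\<Prod>a\<leftarrow>l. [:- a, 1:]) = mset l" for l :: "real list"
  proof (induction l)
    case (Cons a l)
    have "(\<Prod>a\<leftarrow>l. [:- a, 1:]) \<noteq> 0"
      by (auto simp: prod_list_zero_iff)
    then have "proots ([:- a, 1:] * (\<Prod>a\<leftarrow>l. [:- a, 1:])) = {#a#} + mset l"
      by (subst proots_mult) (simp_all add: Cons.IH)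
    then show ?case
      by (simp only: list.map prod_list.Cons mset.simps) simp
  qed simp
  ultimately have "mset es = mset d"
    by (simp add: es_def)
  \<comment> \<open>The diagonal of \<open>D\<close> need not be sorted; \<open>\<pi>\<close> lists its positions in increasing order of the entries.\<close>
  then obtain \<pi> where \<pi>: "\<pi> permutes {..<n}" and es: "permute_list \<pi> d = es"
    using d mset_eq_permutation by metis
  have es_nth: "es ! j = d ! \<pi> j" if "j < n" for j
    using es permute_list_nth[of \<pi> d j] \<pi> d that by simp
  have \<pi>_less: "\<pi> j < n" if "j < n" for j
    using permutes_in_image[OF \<pi>, of j] that by simp
  have \<pi>_eq: "\<pi> i = \<pi> j \<longleftrightarrow> i = j" for i j
    using permutes_inj[OF \<pi>] by (auto dest: injD)
  have reindex: "(\<Sum>j<n. h (\<pi> j)) = (\<Sum>j<n. h j)" for h :: "nat \<Rightarrow> real"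
    using sum.permute[OF \<pi>, of h] by (simp add: comp_def)
  define idx where "idx = inv_into {..<n} ((!) vs)"
  have idx: "idx (vs ! i) = i" if "i < n" for i
    using bij that by (auto simp: idx_def bij_betw_def intro: inv_into_f_f)
  define p where "p j u = U $$ (idx u, \<pi> j) / sqrt (w u)" for j u
  have p: "p j (vs ! i) = U $$ (i, \<pi> j) / s i" if "i < n" for i j
    using that by (simp add: p_def idx s_def)
  have sumV: "(\<Sum>u\<in>V. h u) = (\<Sum>i<n. h (vs ! i))" for h :: "'v \<Rightarrow> real"
    using sum.reindex_bij_betw[OF bij, of h] by simp
  have coord: "weighted_inner V w g (p j) = (\<Sum>i<n. s i * g (vs ! i) * U $$ (i, \<pi> j))" for g j
    unfolding weighted_inner_def sumV
    by (intro sum.cong refl) (use s in \<open>auto simp: p s(2)[symmetric] field_simps\<close>)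
  \<comment> \<open>Used twice: \<open>e = 1\<close> yields the Parseval identity, the diagonal \<open>e = d\<close> yields the quadratic form.\<close>
  have expand: "(\<Sum>j<n. e j * (\<Sum>i<n. x i * U $$ (i, j))\<^sup>2)
      = (\<Sum>i<n. \<Sum>k<n. x i * x k * (\<Sum>j<n. e j * (U $$ (i, j) * U $$ (k, j))))" for e x :: "nat \<Rightarrow> real"
  proof -
    have "(\<Sum>j<n. e j * (\<Sum>i<n. x i * U $$ (i, j))\<^sup>2)
        = (\<Sum>j<n. \<Sum>i<n. \<Sum>k<n. x i * x k * (e j * (U $$ (i, j) * U $$ (k, j))))"
      unfolding power2_eq_square sum_product sum_distrib_left
      by (intro sum.cong refl) (simp add: sum_distrib_left mult_ac)
    also have "\<dots> = (\<Sum>i<n. \<Sum>j<n. \<Sum>k<n. x i * x k * (e j * (U $$ (i, j) * U $$ (k, j))))"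
      by (rule sum.swap)
    also have "\<dots> = (\<Sum>i<n. \<Sum>k<n. \<Sum>j<n. x i * x k * (e j * (U $$ (i, j) * U $$ (k, j))))"
      by (intro sum.cong refl sum.swap)
    finally show ?thesis
      by (simp add: sum_distrib_left)
  qed
  have "length es = card V"
    using es d card by auto
  moreover have "sorted es"
    by (simp add: es_def)
  moreover have "weighted_inner V w (p i) (p j) = of_bool (i = j)" if "i < n" "j < n" for i j
  proof -
    have "weighted_inner V w (p i) (p j) = (\<Sum>l<n. U $$ (l, \<pi> i) * U $$ (l, \<pi> j))"
      unfolding coord by (intro sum.cong refl) (use s(1) in \<open>force simp: p\<close>)
    then show ?thesis
      using that by (simp add: col \<pi>_less \<pi>_eq)
  qed
  moreover have "weighted_inner V w g g = (\<Sum>j<n. (weighted_inner V w g (p j))\<^sup>2)" for g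
  proof -
    have "(\<Sum>j<n. (weighted_inner V w g (p j))\<^sup>2)
        = (\<Sum>j<n. 1 * (\<Sum>i<n. s i * g (vs ! i) * U $$ (i, j))\<^sup>2)"
      unfolding coord
      using reindex[of "\<lambda>j. (\<Sum>i<n. s i * g (vs ! i) * U $$ (i, j))\<^sup>2"] by simp
    also have "\<dots> = (\<Sum>i<n. \<Sum>k<n. if k = i then w (vs ! i) * g (vs ! i) * g (vs ! i) else 0)"
      unfolding expand by (intro sum.cong refl) (auto simp: row s(2)[symmetric])
    also have "\<dots> = weighted_inner V w g g"
      by (simp add: weighted_inner_def sumV)
    finally show ?thesis ..
  qed
  moreover have "quad_form V K g = (\<Sum>j<n. es ! j * (weighted_inner V w g (p j))\<^sup>2)" for g
  proof -
    have "(\<Sum>j<n. es ! j * (weighted_inner V w g (p j))\<^sup>2)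
        = (\<Sum>j<n. d ! \<pi> j * (\<Sum>i<n. s i * g (vs ! i) * U $$ (i, \<pi> j))\<^sup>2)"
      unfolding coord by (simp add: es_nth)
    also have "\<dots> = (\<Sum>j<n. d ! j * (\<Sum>i<n. s i * g (vs ! i) * U $$ (i, j))\<^sup>2)"
      by (rule reindex)
    also have "\<dots> = quad_form V K g"
      unfolding expand quad_form_def sumV by (intro sum.cong refl) (simp add: Nij)
    finally show ?thesis ..
  qed
  ultimately show ?thesis
    unfolding principal_axes_def es_def[symmetric] card by blast
qed

section \<open>Linear systems indexed by finite sets\<close>

text \<open>Zero rows pad the system to a square one, whose determinant then vanishes.\<close>

lemma underdetermined_system_solution:
  fixes a :: "'i \<Rightarrow> 'j \<Rightarrow> real"
  assumes "finite I" "finite J" "card I < card J"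
  shows "\<exists>c. (\<exists>j\<in>J. c j \<noteq> 0) \<and> (\<forall>i\<in>I. (\<Sum>j\<in>J. a i j * c j) = 0)"
proof -
  define m n where "m = card I" and "n = card J"
  obtain f where f: "bij_betw f {..<m} I"
    using ex_bij_betw_nat_finite[OF \<open>finite I\<close>] by (auto simp: m_def atLeast0LessThan)
  obtain h where h: "bij_betw h {..<n} J"
    using ex_bij_betw_nat_finite[OF \<open>finite J\<close>] by (auto simp: n_def atLeast0LessThan)
  have "m < n"
    using assms by (simp add: m_def n_def)
  define A where "A = mat n n (\<lambda>(r, q). if r < m then a (f r) (h q) else 0)"
  have A: "A \<in> carrier_mat n n"
    by (simp add: A_def)
  have "det A = 0"
  proof -
    have "A = mat\<^sub>r n n (\<lambda>r. if r = m then 0\<^sub>v n else row A r)"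
      by (rule eq_matI) (auto simp: A_def)
    then show ?thesis
      using det_row_0[OF \<open>m < n\<close>, of "row A"] A by simp
  qed
  then obtain v where v: "v \<in> carrier_vec n" "v \<noteq> 0\<^sub>v n" "A *\<^sub>v v = 0\<^sub>v n"
    using det_0_iff_vec_prod_zero[OF A] by auto
  define ix where "ix = inv_into {..<n} h"
  have ix: "ix (h q) = q" if "q < n" for q
    using h that by (auto simp: ix_def bij_betw_def intro: inv_into_f_f)
  define c where "c j = v $ ix j" for j
  obtain q where "q < n" "v $ q \<noteq> 0"
    using v by (metis carrier_vecD dim_vec eq_vecI index_zero_vec(1) index_zero_vec(2))
  then have "\<exists>j\<in>J. c j \<noteq> 0"
    using h by (intro bexI[of _ "h q"]) (auto simp: c_def ix bij_betw_def)
  moreover have "(\<Sum>j\<in>J. a i j * c j) = 0" if "i \<in> I" for i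
  proof -
    have "i \<in> f ` {..<m}"
      using f that by (simp add: bij_betw_def)
    then obtain r where r: "r < m" "i = f r"
      by auto
    have "(\<Sum>j\<in>J. a i j * c j) = (\<Sum>q<n. a i (h q) * v $ q)"
      using sum.reindex_bij_betw[OF h, of "\<lambda>j. a i j * c j"] by (simp add: c_def ix)
    also have "\<dots> = (A *\<^sub>v v) $ r"
      using r \<open>m < n\<close> v(1) by (simp add: A_def scalar_prod_def atLeast0LessThan)
    finally show ?thesis
      using r \<open>m < n\<close> v by simp
  qed
  ultimately show ?thesis
    by blast
qed

text \<open>Regard the right-hand side as the column of one more unknown \<open>t\<close>, indexed by \<open>None\<close>: the resulting
  homogeneous system has more unknowns than equations. A nonzero solution has \<open>t \<noteq> 0\<close> by injectivity,
  and dividing by \<open>t\<close> solves the original system.\<close>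

lemma injective_system_solvable:
  fixes a :: "'i \<Rightarrow> 'i \<Rightarrow> real" and b :: "'i \<Rightarrow> real"
  assumes "finite I"
    and inj: "\<And>h. \<forall>i\<in>I. (\<Sum>j\<in>I. a i j * h j) = 0 \<Longrightarrow> \<forall>j\<in>I. h j = 0"
  shows "\<exists>h. \<forall>i\<in>I. (\<Sum>j\<in>I. a i j * h j) = b i"
proof -
  let ?J = "insert None (Some ` I)"
  have card: "card ?J = Suc (card I)"
    using \<open>finite I\<close> by (subst card_insert_disjoint) (auto simp: card_image)
  obtain c where c: "\<exists>j\<in>?J. c j \<noteq> 0"
    and eq: "\<forall>i\<in>I. (\<Sum>j\<in>?J. (case j of None \<Rightarrow> - b i | Some j' \<Rightarrow> a i j') * c j) = 0"
    using underdetermined_system_solution[of I ?J "\<lambda>i j. case j of None \<Rightarrow> - b i | Some j' \<Rightarrow> a i j'"]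
      card \<open>finite I\<close> by auto
  have eq': "(\<Sum>j\<in>I. a i j * c (Some j)) = b i * c None" if "i \<in> I" for i
    using bspec[OF eq that] \<open>finite I\<close> by (simp add: sum.reindex)
  have "c None \<noteq> 0"
    using inj[of "\<lambda>j. c (Some j)"] eq' c by auto
  then have "(\<Sum>j\<in>I. a i j * (c (Some j) / c None)) = b i" if "i \<in> I" for i
    using eq'[OF that] by (simp add: sum_divide_distrib[symmetric] field_simps)
  then show ?thesis
    by (intro exI[of _ "\<lambda>j. c (Some j) / c None"]) blast
qed

section \<open>The min-max principle\<close>

lemma weighted_inner_sum_left:
  "weighted_inner V w (\<lambda>u. \<Sum>j\<in>J. c j * b j u) g = (\<Sum>j\<in>J. weighted_inner V w (b j) g * c j)"
proof -
  have "weighted_inner V w (\<lambda>u. \<Sum>j\<in>J. c j * b j u) g = (\<Sum>u\<in>V. \<Sum>j\<in>J. w u * b j u * g u * c j)"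
    unfolding weighted_inner_def sum_distrib_left sum_distrib_right
    by (intro sum.cong refl) simp
  also have "\<dots> = (\<Sum>j\<in>J. \<Sum>u\<in>V. w u * b j u * g u * c j)"
    by (rule sum.swap)
  finally show ?thesis
    by (simp add: weighted_inner_def sum_distrib_right)
qed

text \<open>The test space on which the Rayleigh quotient is at most \<open>t\<close> is given by \<open>N\<close> parameters \<open>c\<close> subject to
  the linear constraints \<open>a\<close>. So its dimension is at least \<open>N - card I > i\<close>, and it contains a function orthogonal to the first \<open>i\<close> axes, on which the Rayleigh quotient is at least \<open>es ! i\<close>. Positivity
  of the norm for nonzero parameters takes the place of linear independence of the \<open>b j\<close>.\<close>

lemma eigenvalue_le_min_max:
  fixes b :: "nat \<Rightarrow> 'v \<Rightarrow> real" and a :: "'i \<Rightarrow> nat \<Rightarrow> real"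
  assumes axes: "principal_axes V w K es p" and "i < card V"
    and "finite I" and dim: "card I + i < N"
    and bound: "\<And>c. \<exists>j<N. c j \<noteq> 0 \<Longrightarrow> \<forall>l\<in>I. (\<Sum>j<N. a l j * c j) = 0 \<Longrightarrow>
      weighted_inner V w (\<lambda>u. \<Sum>j<N. c j * b j u) (\<lambda>u. \<Sum>j<N. c j * b j u) > 0 \<and>
      quad_form V K (\<lambda>u. \<Sum>j<N. c j * b j u) \<le>
        t * weighted_inner V w (\<lambda>u. \<Sum>j<N. c j * b j u) (\<lambda>u. \<Sum>j<N. c j * b j u)"
  shows "es ! i \<le> t"
proof -
  let ?E = "I <+> {..<i}"
  let ?a = "\<lambda>e j. case e of Inl l \<Rightarrow> a l j | Inr l \<Rightarrow> weighted_inner V w (b j) (p l)"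
  obtain c where c: "\<exists>j\<in>{..<N}. c j \<noteq> 0" "\<forall>e\<in>?E. (\<Sum>j\<in>{..<N}. ?a e j * c j) = 0"
    using underdetermined_system_solution[of ?E "{..<N}" ?a] \<open>finite I\<close> dim
    by (auto simp: card_Plus)
  define g where "g u = (\<Sum>j<N. c j * b j u)" for u
  have "\<forall>l\<in>I. (\<Sum>j<N. a l j * c j) = 0"
    using c(2) by force
  moreover have "\<exists>j<N. c j \<noteq> 0"
    using c(1) by auto
  ultimately have g: "weighted_inner V w g g > 0" "quad_form V K g \<le> t * weighted_inner V w g g"
    using bound[of c] unfolding g_def[abs_def] by blast+
  have orth: "weighted_inner V w g (p l) = 0" if "l < i" for l
    using bspec[OF c(2), of "Inr l"] that unfolding g_def[abs_def] weighted_inner_sum_left by auto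
  have "es ! i * weighted_inner V w g g = (\<Sum>l<card V. es ! i * (weighted_inner V w g (p l))\<^sup>2)"
    using axes unfolding principal_axes_def by (metis sum_distrib_left)
  also have "\<dots> \<le> (\<Sum>l<card V. es ! l * (weighted_inner V w g (p l))\<^sup>2)"
  proof (rule sum_mono)
    fix l assume "l \<in> {..<card V}"
    then have "l < i \<or> es ! i \<le> es ! l"
      using axes unfolding principal_axes_def by (auto intro: sorted_nth_mono)
    then show "es ! i * (weighted_inner V w g (p l))\<^sup>2 \<le> es ! l * (weighted_inner V w g (p l))\<^sup>2"
      using orth[of l] by (auto intro: mult_right_mono)
  qed
  also have "\<dots> = quad_form V K g"
    using axes by (simp add: principal_axes_def)
  also have "\<dots> \<le> t * weighted_inner V w g g"
    by (rule g)
  finally show ?thesis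
    using g(1) by simp
qed

lemma span_of_lowest_axes:
  assumes axes: "principal_axes V w K es p" and "0 < N" "N \<le> card V"
  defines "g \<equiv> \<lambda>c u. \<Sum>j<N. c j * p j u"
  shows "weighted_inner V w (g c) (g c) = (\<Sum>j<N. (c j)\<^sup>2)"
    and "quad_form V K (g c) \<le> es ! (N - 1) * weighted_inner V w (g c) (g c)"
proof -
  have coord: "weighted_inner V w (g c) (p l) = (if l < N then c l else 0)" if "l < card V" for l
  proof -
    have "weighted_inner V w (g c) (p l) = (\<Sum>j<N. if j = l then c l else 0)"
      unfolding g_def weighted_inner_sum_left using axes that \<open>N \<le> card V\<close>
      by (intro sum.cong refl) (auto simp: principal_axes_def)
    then show ?thesis
      by simp
  qed
  have cut: "(\<Sum>l<card V. if l < N then h l else 0) = (\<Sum>l<N. h l)" for h :: "nat \<Rightarrow> real"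
    using \<open>N \<le> card V\<close> by (intro sum.mono_neutral_cong_right) auto
  have "weighted_inner V w (g c) (g c) = (\<Sum>l<card V. if l < N then (c l)\<^sup>2 else 0)"
    using axes unfolding principal_axes_def
    by (auto simp: coord intro!: sum.cong)
  then show norm: "weighted_inner V w (g c) (g c) = (\<Sum>j<N. (c j)\<^sup>2)"
    by (simp add: cut)
  have "quad_form V K (g c) = (\<Sum>l<card V. if l < N then es ! l * (c l)\<^sup>2 else 0)"
    using axes unfolding principal_axes_def
    by (auto simp: coord intro!: sum.cong)
  also have "\<dots> = (\<Sum>l<N. es ! l * (c l)\<^sup>2)"
    by (simp add: cut)
  also have "\<dots> \<le> (\<Sum>l<N. es ! (N - 1) * (c l)\<^sup>2)"
    using axes \<open>0 < N\<close> \<open>N \<le> card V\<close> unfolding principal_axes_def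
    by (intro sum_mono mult_right_mono) (auto intro: sorted_nth_mono)
  finally show "quad_form V K (g c) \<le> es ! (N - 1) * weighted_inner V w (g c) (g c)"
    by (simp add: norm sum_distrib_left)
qed

section \<open>The energy of a weighted multigraph\<close>

lemma tot_weight_sym: "tot_weight G u v = tot_weight G v u"
proof -
  have "Upair u v = Upair v u"
    by simp
  then show ?thesis
    unfolding tot_weight_def by (subst \<open>Upair u v = Upair v u\<close>) auto
qed

lemma tot_weight_nonneg:
  assumes "weighted_multigraph G"
  shows "tot_weight G u v \<ge> 0"
  using assms unfolding tot_weight_def weighted_multigraph_def
  by (intro mult_nonneg_nonneg sum_nonneg) (auto simp: less_imp_le)

lemma adj_tot_weight_pos:
  assumes G: "weighted_multigraph G" and "(u, v) \<in> adj G"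
  shows "u \<in> verts G" "v \<in> verts G" "tot_weight G u v > 0"
proof -
  obtain e where e: "e \<in> edges G" "ends G e = Upair u v"
    using assms by (auto simp: adj_def)
  then have "set_uprod (Upair u v) \<subseteq> verts G"
    using G by (metis weighted_multigraph_def)
  then show "u \<in> verts G" "v \<in> verts G"
    by auto
  have "(\<Sum>e | e \<in> edges G \<and> ends G e = Upair u v. eweight G e) > 0"
    using G e by (intro sum_pos2[of _ e]) (auto simp: weighted_multigraph_def less_imp_le)
  then show "tot_weight G u v > 0"
    by (simp add: tot_weight_def)
qed

text \<open>Expand the squares and use the symmetry of the edge weights. A loop adds the same amount to the degree
  and to the adjacency matrix and so drops out, as it does from the differences on the right. The
  division by two is there because the double sum meets each pair of vertices in both orders.\<close>

lemma laplacian_energy: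
  "quad_form (verts G) (comb_laplacian G) g =
    (\<Sum>u\<in>verts G. \<Sum>v\<in>verts G. tot_weight G u v * (g u - g v)\<^sup>2) / 2"
proof (cases "finite (verts G)")
  case True
  let ?V = "verts G" and ?t = "tot_weight G"
  let ?A = "\<Sum>u\<in>?V. \<Sum>v\<in>?V. ?t u v * (g u)\<^sup>2"
  let ?B = "\<Sum>u\<in>?V. \<Sum>v\<in>?V. ?t u v * g u * g v"
  have "quad_form ?V (comb_laplacian G) g =
      (\<Sum>u\<in>?V. \<Sum>v\<in>?V. (if v = u then wdegree G u * (g u)\<^sup>2 else 0) - ?t u v * g u * g v)"
    unfolding quad_form_def comb_laplacian_def
    by (intro sum.cong refl) (auto simp: power2_eq_square algebra_simps)
  also have "\<dots> = ?A - ?B"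
    using True by (simp add: sum_subtractf wdegree_def sum_distrib_right)
  finally have Q: "quad_form ?V (comb_laplacian G) g = ?A - ?B" .
  have "?A = (\<Sum>v\<in>?V. \<Sum>u\<in>?V. ?t u v * (g u)\<^sup>2)"
    by (rule sum.swap)
  also have "\<dots> = (\<Sum>u\<in>?V. \<Sum>v\<in>?V. ?t u v * (g v)\<^sup>2)"
    by (subst tot_weight_sym) (rule refl)
  finally have A: "?A = (\<Sum>u\<in>?V. \<Sum>v\<in>?V. ?t u v * (g v)\<^sup>2)" .
  have "(\<Sum>u\<in>?V. \<Sum>v\<in>?V. ?t u v * (g u - g v)\<^sup>2) =
      (\<Sum>u\<in>?V. \<Sum>v\<in>?V. ?t u v * (g u)\<^sup>2 + ?t u v * (g v)\<^sup>2 - 2 * (?t u v * g u * g v))"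
    by (intro sum.cong refl) (simp add: power2_eq_square algebra_simps)
  also have "\<dots> = ?A + ?A - 2 * ?B"
    by (subst (2) A) (simp add: sum.distrib sum_subtractf sum_distrib_left)
  finally show ?thesis
    by (simp add: Q)
qed (simp add: quad_form_def)

lemma laplacian_energy_nonneg:
  assumes "weighted_multigraph G"
  shows "quad_form (verts G) (comb_laplacian G) g \<ge> 0"
  unfolding laplacian_energy using tot_weight_nonneg[OF assms] by (simp add: sum_nonneg)

text \<open>All terms of the energy are nonnegative, so each vanishes, and adjacent vertices carry equal values.\<close>

lemma zero_energy_constant_on_component:
  assumes G: "weighted_multigraph G" and zero: "quad_form (verts G) (comb_laplacian G) g = 0"
    and "(u, v) \<in> (adj G)\<^sup>*"
  shows "g u = g v"
  using assms(3)
proof (induction rule: rtrancl_induct)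
  case (step x y)
  have fin: "finite (verts G)"
    using G by (simp add: weighted_multigraph_def)
  note xy = adj_tot_weight_pos[OF G step.hyps(2)]
  have nn: "tot_weight G a b * (g a - g b)\<^sup>2 \<ge> 0" for a b
    using tot_weight_nonneg[OF G] by simp
  have "(\<Sum>a\<in>verts G. \<Sum>b\<in>verts G. tot_weight G a b * (g a - g b)\<^sup>2) = 0"
    using zero by (simp add: laplacian_energy)
  then have "(\<Sum>b\<in>verts G. tot_weight G x b * (g x - g b)\<^sup>2) = 0"
    using xy fin nn by (subst (asm) sum_nonneg_eq_0_iff) (auto intro: sum_nonneg)
  then have "tot_weight G x y * (g x - g y)\<^sup>2 = 0"
    using xy fin nn by (subst (asm) sum_nonneg_eq_0_iff) auto
  then show ?case
    using xy step.IH by simp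
qed simp

lemma bilinear_form_eq_inner_laplacian:
  assumes "weighted_multigraph G"
  shows "(\<Sum>u\<in>verts G. \<Sum>v\<in>verts G. comb_laplacian G u v * h u * g v) =
    weighted_inner (verts G) (vweight G) h (laplacian_op G g)"
  unfolding weighted_inner_def laplacian_op_def laplacian_def sum_distrib_left
proof (intro sum.cong refl)
  fix u v assume "u \<in> verts G"
  then have "vweight G u > 0"
    using assms by (simp add: weighted_multigraph_def)
  then show "comb_laplacian G u v * h u * g v
      = vweight G u * h u * (comb_laplacian G u v / vweight G u * g v)"
    by simp
qed

lemma laplacian_op_sum:
  "laplacian_op G (\<lambda>v. \<Sum>j\<in>J. c j * b j v) u = (\<Sum>j\<in>J. c j * laplacian_op G (b j) u)"
proof -
  have "laplacian_op G (\<lambda>v. \<Sum>j\<in>J. c j * b j v) u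
      = (\<Sum>v\<in>verts G. \<Sum>j\<in>J. c j * (laplacian G u v * b j v))"
    unfolding laplacian_op_def sum_distrib_left by (intro sum.cong refl) simp
  also have "\<dots> = (\<Sum>j\<in>J. \<Sum>v\<in>verts G. c j * (laplacian G u v * b j v))"
    by (rule sum.swap)
  finally show ?thesis
    by (simp add: laplacian_op_def sum_distrib_left)
qed

lemma comb_laplacian_sym: "comb_laplacian G u v = comb_laplacian G v u"
  unfolding comb_laplacian_def by (auto simp: tot_weight_sym)

lemma laplacian_principal_axes:
  assumes "weighted_multigraph G"
  shows "\<exists>p. principal_axes (verts G) (vweight G) (comb_laplacian G) (laplacian_eigenvalues G) p"
proof -
  have "laplacian G = (\<lambda>u v. comb_laplacian G u v / vweight G u)"
    by (intro ext) (simp add: laplacian_def)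
  moreover have "finite (verts G)" "\<And>u. u \<in> verts G \<Longrightarrow> vweight G u > 0"
    using assms by (auto simp: weighted_multigraph_def)
  ultimately show ?thesis
    unfolding laplacian_eigenvalues_def
    using principal_axes_exist[of "verts G" "vweight G" "comb_laplacian G"] comb_laplacian_sym[of G]
    by simp
qed

section \<open>Harmonic extensions and Kron reductions\<close>

text \<open>Extensions are chosen for each function separately; this lemma makes linear combinations of the choices
  harmonic extensions again, so that no linear choice has to be constructed.\<close>

lemma harmonic_extension_sum:
  assumes "\<And>j. j \<in> J \<Longrightarrow> harmonic_extension G S (f j) (g j)"
  shows "harmonic_extension G S (\<lambda>u. \<Sum>j\<in>J. c j * f j u) (\<lambda>u. \<Sum>j\<in>J. c j * g j u)"
  using assms unfolding harmonic_extension_def laplacian_op_sum by auto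

text \<open>The values on \<open>S\<close> solve a square linear system, so it suffices that its homogeneous version has only
  the zero solution. Such a solution, extended by zero, has zero energy: at each vertex it or its
  Laplacian vanishes. Hence it is constant on components; every component leaves \<open>S\<close>, where the
  extension is zero.\<close>

lemma harmonic_extension_exists:
  assumes G: "weighted_multigraph G" and S: "S \<subseteq> verts G"
    and comps: "\<forall>C\<in>components G. \<not> C \<subseteq> S"
  shows "\<exists>g. harmonic_extension G S f g"
proof -
  have fin: "finite (verts G)" "finite S"
    using G S by (auto simp: weighted_multigraph_def intro: finite_subset)
  have split: "laplacian_op G g v =
      (\<Sum>u\<in>verts G - S. laplacian G v u * g u) + (\<Sum>u\<in>S. laplacian G v u * g u)" for g v
    unfolding laplacian_op_def by (rule sum.subset_diff[OF S fin(1)])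
  have "\<exists>h. \<forall>v\<in>S. (\<Sum>u\<in>S. laplacian G v u * h u) = - (\<Sum>u\<in>verts G - S. laplacian G v u * f u)"
  proof (rule injective_system_solvable[OF fin(2)])
    fix h assume h: "\<forall>v\<in>S. (\<Sum>u\<in>S. laplacian G v u * h u) = 0"
    define g where "g u = (if u \<in> S then h u else 0)" for u
    have "laplacian_op G g v = 0" if "v \<in> S" for v
      unfolding split using h that by (simp add: g_def)
    then have "quad_form (verts G) (comb_laplacian G) g = 0"
      unfolding quad_form_def bilinear_form_eq_inner_laplacian[OF G] weighted_inner_def
      by (intro sum.neutral) (auto simp: g_def)
    note const = zero_energy_constant_on_component[OF G this]
    show "\<forall>v\<in>S. h v = 0"
    proof
      fix v assume "v \<in> S"
      then have "(adj G)\<^sup>* `` {v} \<in> components G"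
        using S by (auto simp: components_def)
      then obtain x where "(v, x) \<in> (adj G)\<^sup>*" "x \<notin> S"
        using comps by blast
      then show "h v = 0"
        using const[of v x] \<open>v \<in> S\<close> by (simp add: g_def)
    qed
  qed
  then obtain h where
    h: "\<forall>v\<in>S. (\<Sum>u\<in>S. laplacian G v u * h u) = - (\<Sum>u\<in>verts G - S. laplacian G v u * f u)"
    by blast
  define g where "g u = (if u \<in> S then h u else f u)" for u
  have "laplacian_op G g v = 0" if "v \<in> S" for v
  proof -
    have "(\<Sum>u\<in>verts G - S. laplacian G v u * g u) = (\<Sum>u\<in>verts G - S. laplacian G v u * f u)"
      by (intro sum.cong) (auto simp: g_def)
    moreover have "(\<Sum>u\<in>S. laplacian G v u * g u) = (\<Sum>u\<in>S. laplacian G v u * h u)"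
      by (intro sum.cong) (auto simp: g_def)
    ultimately show ?thesis
      unfolding split using h that by simp
  qed
  then have "harmonic_extension G S f g"
    unfolding harmonic_extension_def by (simp add: g_def)
  then show ?thesis
    by blast
qed

text \<open>Write \<open>g = e + h\<close>. On \<open>S\<close> the Laplacian of \<open>e\<close> vanishes and off \<open>S\<close> the difference \<open>h\<close> does, so the mixed terms
  of the energy of \<open>g\<close> are zero, and the energy of \<open>h\<close> is nonnegative.\<close>

lemma harmonic_extension_minimises_energy:
  assumes G: "weighted_multigraph G" and e: "harmonic_extension G S f e"
    and g: "\<And>u. u \<in> verts G - S \<Longrightarrow> g u = f u"
  shows "quad_form (verts G) (comb_laplacian G) e \<le> quad_form (verts G) (comb_laplacian G) g"
proof -
  let ?V = "verts G" and ?K = "comb_laplacian G"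
  define h where "h u = g u - e u" for u
  have "weighted_inner ?V (vweight G) h (laplacian_op G e) = 0"
    unfolding weighted_inner_def using e g
    by (intro sum.neutral) (auto simp: h_def harmonic_extension_def)
  then have cross: "(\<Sum>u\<in>?V. \<Sum>v\<in>?V. ?K u v * h u * e v) = 0"
    by (simp add: bilinear_form_eq_inner_laplacian[OF G])
  have "(\<Sum>u\<in>?V. \<Sum>v\<in>?V. ?K u v * e u * h v) = (\<Sum>v\<in>?V. \<Sum>u\<in>?V. ?K u v * e u * h v)"
    by (rule sum.swap)
  also have "\<dots> = (\<Sum>u\<in>?V. \<Sum>v\<in>?V. ?K u v * h u * e v)"
    by (intro sum.cong refl) (simp add: comb_laplacian_sym mult_ac)
  finally have cross': "(\<Sum>u\<in>?V. \<Sum>v\<in>?V. ?K u v * e u * h v) = 0"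
    by (simp add: cross)
  have "quad_form ?V ?K g = (\<Sum>u\<in>?V. \<Sum>v\<in>?V. ?K u v * e u * e v + ?K u v * h u * h v
      + ?K u v * h u * e v + ?K u v * e u * h v)"
    unfolding quad_form_def h_def by (intro sum.cong refl) (simp add: algebra_simps)
  also have "\<dots> = quad_form ?V ?K e + quad_form ?V ?K h"
    by (simp add: sum.distrib cross cross' quad_form_def)
  finally show ?thesis
    using laplacian_energy_nonneg[OF G, of h] by simp
qed

text \<open>Both energies are inner products of a function with its Laplacian. Outside \<open>S\<close> the two integrands agree by
  the definition of a Kron reduction, and on \<open>S\<close> the integrand of \<open>G\<close> vanishes.\<close>

lemma kron_reduction_energy:
  assumes G: "weighted_multigraph G" and H: "kron_reduction G S H"
    and S: "S \<subseteq> verts G" and e: "harmonic_extension G S f e"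
  shows "quad_form (verts H) (comb_laplacian H) f = quad_form (verts G) (comb_laplacian G) e"
proof -
  have V: "verts H = verts G - S" and "weighted_multigraph H"
    using H by (auto simp: kron_reduction_def)
  have "finite (verts G)"
    using G by (simp add: weighted_multigraph_def)
  have "quad_form (verts H) (comb_laplacian H) f
      = weighted_inner (verts H) (vweight H) f (laplacian_op H f)"
    unfolding quad_form_def by (rule bilinear_form_eq_inner_laplacian) fact
  also have "\<dots> = (\<Sum>u\<in>verts G - S. vweight G u * e u * laplacian_op G e u)"
    unfolding weighted_inner_def V[symmetric] using H e
    by (intro sum.cong refl) (auto simp: kron_reduction_def harmonic_extension_def)
  also have "\<dots> = weighted_inner (verts G) (vweight G) e (laplacian_op G e)"
    unfolding weighted_inner_def using \<open>finite (verts G)\<close> S e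
    by (intro sum.mono_neutral_left) (auto simp: harmonic_extension_def)
  also have "\<dots> = quad_form (verts G) (comb_laplacian G) e"
    unfolding quad_form_def by (rule bilinear_form_eq_inner_laplacian[OF G, symmetric])
  finally show ?thesis .
qed

section \<open>Eigenvalue interlacing\<close>

theorem theorem6p7:
  fixes G :: "('v, 'e) wgraph" and H :: "('v, 'f) wgraph"
    and S :: "'v set" and n k :: nat
  assumes "weighted_multigraph G"
    and "card (verts G) = n"
    and "S \<subseteq> verts G"
    and "card S = k"
    and "\<forall>C\<in>components G. \<not> C \<subseteq> S"
    and "kron_reduction G S H"
  shows "\<forall>i\<in>{1..n - k}.
    laplacian_eigenvalue G i \<le> laplacian_eigenvalue H i \<and>
    laplacian_eigenvalue H i \<le> laplacian_eigenvalue G (i + k)"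
proof
  fix i assume i: "i \<in> {1..n - k}"
  note G = assms(1)
  have H: "weighted_multigraph H" and V: "verts H = verts G - S"
    and wH: "\<And>u. u \<in> verts H \<Longrightarrow> vweight H u = vweight G u"
    using assms(6) by (auto simp: kron_reduction_def)
  have fin: "finite (verts G)" "finite S"
    using G assms(3) by (auto simp: weighted_multigraph_def intro: finite_subset)
  have wG: "vweight G u > 0" if "u \<in> verts G" for u
    using G that by (simp add: weighted_multigraph_def)
  have cardH: "card (verts H) = n - k"
    using fin assms by (simp add: V card_Diff_subset)
  obtain p where p: "principal_axes (verts G) (vweight G) (comb_laplacian G) (laplacian_eigenvalues G) p"
    using laplacian_principal_axes[OF G] by blast
  obtain q where q: "principal_axes (verts H) (vweight H) (comb_laplacian H) (laplacian_eigenvalues H) q"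
    using laplacian_principal_axes[OF H] by blast
  have "\<exists>ext. \<forall>f. harmonic_extension G S f (ext f)"
    using harmonic_extension_exists[OF G assms(3,5)] by metis
  then obtain ext where ext: "\<And>f. harmonic_extension G S f (ext f)"
    by blast
  let ?QG = "quad_form (verts G) (comb_laplacian G)"
  let ?QH = "quad_form (verts H) (comb_laplacian H)"
  let ?NG = "\<lambda>g. weighted_inner (verts G) (vweight G) g g"
  let ?NH = "\<lambda>g. weighted_inner (verts H) (vweight H) g g"
  have NH: "?NH f = (\<Sum>u\<in>verts G - S. vweight G u * f u * f u)" for f
    unfolding weighted_inner_def V[symmetric] by (intro sum.cong refl) (simp add: wH)
  have pos: "(\<Sum>j<N. (c j)\<^sup>2) > 0" if nz: "\<exists>j<N. c j \<noteq> 0" for N and c :: "nat \<Rightarrow> real"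
  proof -
    obtain j where "j < N" "c j \<noteq> 0"
      using nz by blast
    then show ?thesis
      by (intro sum_pos2[of _ j]) auto
  qed
  let ?l = "laplacian_eigenvalues G" and ?m = "laplacian_eigenvalues H"
  \<comment> \<open>Test functions on \<open>G\<close>: harmonic extensions of the span of the \<open>i\<close> lowest axes of \<open>H\<close>.\<close>
  have "?l ! (i - 1) \<le> ?m ! (i - 1)"
  proof (rule eigenvalue_le_min_max[OF p, where I = "{} :: nat set" and N = i and b = "\<lambda>j. ext (q j)"])
    fix c :: "nat \<Rightarrow> real"
    assume c: "\<exists>j<i. c j \<noteq> 0"
    define f where "f u = (\<Sum>j<i. c j * q j u)" for u
    define g where "g u = (\<Sum>j<i. c j * ext (q j) u)" for u
    have fg: "harmonic_extension G S f g"
      unfolding f_def[abs_def] g_def[abs_def] by (rule harmonic_extension_sum) (rule ext)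
    have i': "0 < i" "i \<le> card (verts H)"
      using i cardH by auto
    have Nf: "?NH f > 0"
      unfolding f_def[abs_def] span_of_lowest_axes(1)[OF q i'] by (rule pos[OF c])
    have Qf: "?QH f \<le> ?m ! (i - 1) * ?NH f"
      unfolding f_def[abs_def] by (rule span_of_lowest_axes(2)[OF q i'])
    \<comment> \<open>Nonnegativity of \<open>\<mu>\<^sub>i\<close> is what lets the bound pass from the norm of \<open>f\<close> to the larger norm
      of \<open>g\<close>.\<close>
    have "0 \<le> ?m ! (i - 1) * ?NH f"
      using laplacian_energy_nonneg[OF H] Qf by (rule order_trans)
    then have "?m ! (i - 1) \<ge> 0"
      using Nf by (simp add: zero_le_mult_iff)
    have "?NH f = (\<Sum>u\<in>verts G - S. vweight G u * g u * g u)"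
      unfolding NH using fg by (intro sum.cong refl) (auto simp: harmonic_extension_def)
    also have "\<dots> \<le> ?NG g"
      unfolding weighted_inner_def using fin wG
      by (intro sum_mono2) (auto simp: mult.assoc less_imp_le)
    finally have NN: "?NH f \<le> ?NG g" .
    have "?QG g = ?QH f"
      using kron_reduction_energy[OF G assms(6,3) fg] by simp
    also have "\<dots> \<le> ?m ! (i - 1) * ?NG g"
      using Qf NN \<open>?m ! (i - 1) \<ge> 0\<close> by (meson mult_left_mono order_trans)
    finally show "?NG (\<lambda>u. \<Sum>j<i. c j * ext (q j) u) > 0 \<and>
        ?QG (\<lambda>u. \<Sum>j<i. c j * ext (q j) u) \<le> ?m ! (i - 1) * ?NG (\<lambda>u. \<Sum>j<i. c j * ext (q j) u)"
      using Nf NN unfolding g_def[abs_def] by simp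
  qed (use i assms in auto)
  \<comment> \<open>Test functions on \<open>H\<close>: restrictions of those functions in the span of the \<open>i + k\<close> lowest axes
    of \<open>G\<close> that vanish on \<open>S\<close>.\<close>
  moreover have "?m ! (i - 1) \<le> ?l ! (i + k - 1)"
  proof (rule eigenvalue_le_min_max[OF q, where I = S and N = "i + k" and b = p and a = "\<lambda>s j. p j s"])
    fix c :: "nat \<Rightarrow> real"
    assume c: "\<exists>j<i + k. c j \<noteq> 0" and vanish: "\<forall>s\<in>S. (\<Sum>j<i + k. p j s * c j) = 0"
    define g where "g u = (\<Sum>j<i + k. c j * p j u)" for u
    have g0: "g s = 0" if "s \<in> S" for s
      using vanish that by (simp add: g_def mult.commute)
    have ik: "0 < i + k" "i + k \<le> card (verts G)"
      using i assms by auto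
    have Ng: "?NG g > 0"
      unfolding g_def[abs_def] span_of_lowest_axes(1)[OF p ik] by (rule pos[OF c])
    have "?NH g = ?NG g"
      unfolding NH unfolding weighted_inner_def using fin assms(3) g0
      by (intro sum.mono_neutral_left) auto
    have "?QH g = ?QG (ext g)"
      by (rule kron_reduction_energy[OF G assms(6,3) ext])
    also have "\<dots> \<le> ?QG g"
      by (rule harmonic_extension_minimises_energy[OF G ext]) simp
    also have "\<dots> \<le> ?l ! (i + k - 1) * ?NG g"
      unfolding g_def[abs_def] by (rule span_of_lowest_axes(2)[OF p ik])
    finally show "?NH (\<lambda>u. \<Sum>j<i + k. c j * p j u) > 0 \<and>
        ?QH (\<lambda>u. \<Sum>j<i + k. c j * p j u) \<le> ?l ! (i + k - 1) * ?NH (\<lambda>u. \<Sum>j<i + k. c j * p j u)"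
      using Ng \<open>?NH g = ?NG g\<close> unfolding g_def[abs_def] by simp
  qed (use i assms(4) cardH fin in auto)
  ultimately show "laplacian_eigenvalue G i \<le> laplacian_eigenvalue H i \<and>
      laplacian_eigenvalue H i \<le> laplacian_eigenvalue G (i + k)"
    by (simp add: laplacian_eigenvalue_def)
qed

end
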